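(* There is a function $F(d)$ such that the following holds. Let $C\subset\mathbb{R}^d$ be a convex body and $\mu$ a non-$C$-degenerate measure on $\mathbb{R}^d$ such that $\mu(C)>0$ and $\mu(\mathbb{R}^d)=\infty$. Then $\Theta_H(\mu,C)\le F(d)$.
   Context: A convex body is a convex compact set with nonempty interior; a homothet of $C$ is $\lambda C+x$ with $\lambda>0$, $x\in\mathbb{R}^d$. Measures are Borel measures on $\mathbb{R}^d$ finite on compact sets; $\mu$ is non-$C$-degenerate if it vanishes on the boundary of every homothet of $C$. Let $B^d$ be the open unit Euclidean ball centered at the origin. For a family $\mathcal{A}$ of sets of finite measure and a set $D$ of finite positive measure, $d_{\mathrm{inn}}(\mu,\mathcal{A}|D)=\frac{1}{\mu(D)}\sum_{A\in\mathcal{A},A\subset D}\mu(A)$, and $d_{\mathrm{low}}(\mu,\mathcal{A})=\liminf_{r\to\infty}d_{\mathrm{inn}}(\mu,\mathcal{A}|rB^d)$. The homothety covering density with respect to $\mu$ is $\Theta_H(\mu,C)=\inf\{d_{\mathrm{low}}(\mu,\mathcal{C})\}$, where the infimum is over all coverings $\mathcal{C}$ of $\mathbb{R}^d$ (families whose union is $\mathbb{R}^d$) by homothets of $C$ each of $\mu$-measure exactly $\mu(C)$. *)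

theory Defs
  imports "HOL-Analysis.Analysis"
begin

definition convex_body :: "'a::euclidean_space set \<Rightarrow> bool" where
  "convex_body C \<longleftrightarrow> convex C \<and> compact C \<and> interior C \<noteq> {}"

definition homothet :: "real \<Rightarrow> 'a::euclidean_space \<Rightarrow> 'a set \<Rightarrow> 'a set" where
  "homothet l x C = (\<lambda>y. l *\<^sub>R y + x) ` C"

definition is_homothet_of :: "'a::euclidean_space set \<Rightarrow> 'a set \<Rightarrow> bool" where
  "is_homothet_of A C \<longleftrightarrow> (\<exists>l x. l > 0 \<and> A = homothet l x C)"

definition locally_finite_borel :: "'a::euclidean_space measure \<Rightarrow> bool" where
  "locally_finite_borel \<mu> \<longleftrightarrow> sets \<mu> = sets borel \<and>
     (\<forall>K. compact K \<longrightarrow> emeasure \<mu> K < \<infinity>)"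

definition non_degenerate :: "'a::euclidean_space measure \<Rightarrow> 'a set \<Rightarrow> bool" where
  "non_degenerate \<mu> C \<longleftrightarrow>
     (\<forall>l x. l > 0 \<longrightarrow> emeasure \<mu> (frontier (homothet l x C)) = 0)"

text \<open>Sum of the measures of the members of a family contained in D
  (sum of nonnegative terms = supremum of finite partial sums), divided by mu(D).\<close>
definition d_inn :: "'a::euclidean_space measure \<Rightarrow> 'a set set \<Rightarrow> 'a set \<Rightarrow> ennreal" where
  "d_inn \<mu> \<A> D =
     (SUP F \<in> {F. finite F \<and> F \<subseteq> {A \<in> \<A>. A \<subseteq> D}}. \<Sum>A\<in>F. emeasure \<mu> A) / emeasure \<mu> D"

definition d_low :: "'a::euclidean_space measure \<Rightarrow> 'a set set \<Rightarrow> ennreal" where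
  "d_low \<mu> \<A> = Liminf at_top (\<lambda>r::real. d_inn \<mu> \<A> (ball 0 r))"

definition homothety_covering_density :: "'a::euclidean_space measure \<Rightarrow> 'a set \<Rightarrow> ennreal" where
  "homothety_covering_density \<mu> C =
     (INF \<C> \<in> {\<C>. \<Union>\<C> = UNIV \<and>
                 (\<forall>A\<in>\<C>. is_homothet_of A C \<and> emeasure \<mu> A = emeasure \<mu> C)}. d_low \<mu> \<C>)"

end

theory Submission
  imports Defs
begin

text \<open>By Helly's theorem, \<open>C\<close> may be translated so that \<open>- C \<subseteq> d C\<close>. Non-degeneracy makes
  \<open>\<mu> (x + r C)\<close> continuous in \<open>r\<close>, so every point \<open>x\<close> is the centre of a homothet of measure
  \<open>\<mu> C\<close>. Choosing centres in a bounded set greedily by almost decreasing size, as in Besicovitch's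
  covering theorem, gives a finite covering of that set. If a point \<open>p\<close> lies in the chosen
  homothets \<open>x\<^sub>i + r\<^sub>i C\<close>, write \<open>p = x\<^sub>i + r\<^sub>i v\<^sub>i\<close>: the points \<open>v\<^sub>i \<in> C\<close> carry disjoint copies
  of a fixed multiple of \<open>C\<close>, whence comparing volumes bounds the multiplicity in terms of \<open>d\<close>.

  The space is then covered shell by shell. Homothets from the shells outside a ball are not
  contained in it, and because \<open>\<mu>\<close> has infinite mass the radii can grow so fast that the finitely
  many homothets of all earlier shells are negligible, which suffices for a lower density.\<close>

section \<open>Elementary facts on homothets\<close>

lemma mem_homothet: "p \<in> homothet r x C \<longleftrightarrow> (\<exists>v\<in>C. p = r *\<^sub>R v + x)"
  by (auto simp: homothet_def)

lemma homothet_homothet: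
  "homothet r x (homothet s y C) = homothet (r * s) (r *\<^sub>R y + x) C"
  by (auto simp: homothet_def image_image algebra_simps)

lemma compact_homothet: "compact C \<Longrightarrow> compact (homothet r x C)"
  unfolding homothet_def by (intro compact_continuous_image continuous_intros)

lemma convex_homothet: "convex C \<Longrightarrow> convex (homothet r x C)"
  unfolding homothet_def
  using convex_translation[OF convex_scaling[of C r], of x]
  by (simp add: image_image add.commute)

lemma interior_homothet:
  assumes "r > 0"
  shows "interior (homothet r x C) = homothet r x (interior C)"
proof -
  have *: "homothet r x A = (+) x ` (*\<^sub>R) r ` A" for A
    by (simp add: homothet_def image_image add.commute)
  show ?thesis
    using assms unfolding * interior_translation
    by (simp add: interior_injective_linear_image linear_scaleR injective_scaleR)
qed

section \<open>A centre of bounded asymmetry\<close>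

text \<open>Taking the weight 1 / (n + 1) of \<open>x\<close> out of the centroid leaves nonnegative
  weights, because \<open>card Y\<close> is at most n + 1, and their sum is n / (n + 1). Rescaled by
  (n + 1) / n they give a convex combination: the point of \<open>C\<close> whose shrunken image is
  the centroid.\<close>

lemma centroid_mem_shrunken_copy:
  fixes C :: "'a::euclidean_space set" and n :: real
  assumes "convex C" "finite Y" "Y \<subseteq> C" "x \<in> Y" "real (card Y) \<le> n + 1" "n > 0"
  shows "(1 / real (card Y)) *\<^sub>R \<Sum>Y \<in> homothet (n / (n + 1)) ((1 / (n + 1)) *\<^sub>R x) C"
proof -
  define k where "k = real (card Y)"
  have k: "k > 0" "k \<le> n + 1"
    using assms by (auto simp: k_def card_gt_0_iff)
  define w where "w y = (1 / k - (if y = x then 1 / (n + 1) else 0)) * ((n + 1) / n)" for y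
  have "(\<Sum>y\<in>Y. w y *\<^sub>R y) \<in> C"
  proof (rule convex_sum)
    have "1 / (n + 1) \<le> 1 / k"
      using k by (simp add: frac_le)
    then show "0 \<le> w y" for y
      using assms k by (auto simp: w_def)
    have "(\<Sum>y\<in>Y. 1 / k - (if y = x then 1 / (n + 1) else 0)) = 1 - 1 / (n + 1)"
      using assms k by (auto simp: sum_subtractf k_def)
    then have "sum w Y = (1 - 1 / (n + 1)) * ((n + 1) / n)"
      unfolding w_def sum_distrib_right[symmetric] by simp
    also have "\<dots> = 1"
      using assms by (simp add: diff_divide_distrib[symmetric] diff_divide_eq_iff)
    finally show "sum w Y = 1" .
  qed (use assms in auto)
  moreover have "(1 / k) *\<^sub>R \<Sum>Y = (n / (n + 1)) *\<^sub>R (\<Sum>y\<in>Y. w y *\<^sub>R y) + (1 / (n + 1)) *\<^sub>R x"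
  proof -
    have "(n / (n + 1)) *\<^sub>R (\<Sum>y\<in>Y. w y *\<^sub>R y)
        = (\<Sum>y\<in>Y. (1 / k) *\<^sub>R y - (if y = x then (1 / (n + 1)) *\<^sub>R y else 0))"
      unfolding scaleR_sum_right
    proof (rule sum.cong)
      fix y
      have "n / (n + 1) * w y = 1 / k - (if y = x then 1 / (n + 1) else 0)"
        using assms by (simp add: w_def)
      then show "(n / (n + 1)) *\<^sub>R w y *\<^sub>R y
          = (1 / k) *\<^sub>R y - (if y = x then (1 / (n + 1)) *\<^sub>R y else 0)"
        by (simp add: scaleR_diff_left)
    qed simp
    also have "\<dots> = (1 / k) *\<^sub>R \<Sum>Y - (1 / (n + 1)) *\<^sub>R x"
      using assms by (simp add: sum_subtractf scaleR_sum_right)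
    finally show ?thesis by simp
  qed
  ultimately show ?thesis
    unfolding mem_homothet k_def by blast
qed

text \<open>The copies of \<open>C\<close> shrunk towards its points \<open>x\<close> by the factor \<open>n / (n + 1)\<close> meet
  \<open>n + 1\<close> at a time in a centroid, hence all meet by Helly's theorem.\<close>

lemma exists_centre:
  fixes C :: "'a::euclidean_space set"
  assumes "convex C" "compact C" "C \<noteq> {}"
  obtains c where "c \<in> C"
    "\<And>x. x \<in> C \<Longrightarrow> \<exists>y\<in>C. c - x = real DIM('a) *\<^sub>R (y - c)"
proof -
  define n where "n = real DIM('a)"
  have n: "n > 0" by (simp add: n_def)
  define K where "K x = homothet (n / (n + 1)) ((1 / (n + 1)) *\<^sub>R x) C" for x
  have KC: "K x \<subseteq> C" if "x \<in> C" for x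
  proof
    fix p assume "p \<in> K x"
    then obtain v where v: "v \<in> C" "p = (n / (n + 1)) *\<^sub>R v + (1 / (n + 1)) *\<^sub>R x"
      by (auto simp: K_def mem_homothet)
    show "p \<in> C"
      unfolding v(2)
      by (rule convexD) (use assms v that n in \<open>auto simp: field_simps\<close>)
  qed
  have cent: "\<Inter>(K ` Y) \<noteq> {}" if "finite Y" "Y \<subseteq> C" "card Y \<le> DIM('a) + 1" for Y
  proof -
    have "(1 / real (card Y)) *\<^sub>R \<Sum>Y \<in> K x" if "x \<in> Y" for x
      unfolding K_def
      by (rule centroid_mem_shrunken_copy)
        (use assms that \<open>finite Y\<close> \<open>Y \<subseteq> C\<close> \<open>card Y \<le> DIM('a) + 1\<close> n in \<open>auto simp: n_def\<close>)
    then show ?thesis by blast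
  qed
  have small: "\<Inter>T \<noteq> {}" if T: "T \<subseteq> K ` C" "finite T" "card T \<le> DIM('a) + 1" for T
  proof -
    \<comment> \<open>Helly's theorem counts sets, the centroid argument counts points; an injective
      choice of points keeps both cardinalities equal.\<close>
    obtain U where U: "U \<subseteq> C" "inj_on K U" "T = K ` U"
      using T(1) unfolding subset_image_inj by blast
    then have "finite U" "card U = card T"
      using T(2) by (auto simp: finite_image_iff card_image)
    then show ?thesis
      using cent[of U] U T(3) by auto
  qed
  have fin: "\<Inter>T \<noteq> {}" if T: "T \<subseteq> K ` C" "finite T" for T
  proof (cases "card T \<le> DIM('a) + 1")
    case False
    show ?thesis
    proof (rule Helly)
      show "\<forall>s\<in>T. convex s"
        using T assms by (auto simp: K_def intro: convex_homothet)
      show "\<Inter>t \<noteq> {}" if "t \<subseteq> T" "card t = DIM('a) + 1" for t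
        using small[of t] that T finite_subset by fastforce
    qed (use False in auto)
  qed (use small T in auto)
  \<comment> \<open>Compactness passes from finitely many copies to all of them; \<open>C\<close>
    itself joins the intersection as the compact set.\<close>
  have "C \<inter> \<Inter>(K ` C) \<noteq> {}"
  proof (rule compact_imp_fip_image)
    show "closed (K x)" for x
      unfolding K_def using assms compact_homothet compact_imp_closed by blast
    fix Y assume Y: "finite Y" "Y \<subseteq> C"
    show "C \<inter> \<Inter>(K ` Y) \<noteq> {}"
    proof (cases "Y = {}")
      case False
      have "\<Inter>(K ` Y) \<noteq> {}"
        using Y by (intro fin) auto
      then show ?thesis
        using False KC Y by blast
    qed (use assms in auto)
  qed (use assms in auto)
  then obtain c where c: "c \<in> C" "\<And>x. x \<in> C \<Longrightarrow> c \<in> K x"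
    by blast
  show thesis
  proof (rule that[OF c(1)])
    fix x assume "x \<in> C"
    then obtain y where y: "y \<in> C" "c = (n / (n + 1)) *\<^sub>R y + (1 / (n + 1)) *\<^sub>R x"
      using c(2) by (force simp: K_def mem_homothet)
    have "(n + 1) *\<^sub>R c = n *\<^sub>R y + x"
      using n by (simp add: y(2) scaleR_add_right)
    then have "c - x = n *\<^sub>R (y - c)"
      by (simp add: algebra_simps)
    then show "\<exists>y\<in>C. c - x = real DIM('a) *\<^sub>R (y - c)"
      using y(1) n_def by blast
  qed
qed

section \<open>Multiplicity of greedily chosen homothets\<close>

text \<open>The assumption \<open>reflect\<close> says that \<open>- C\<close> lies in d times
  \<open>C\<close>. It bounds the asymmetry about the origin by the dimension alone, which keeps the
  later multiplicity bound independent of \<open>C\<close>.\<close>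

locale centred_body =
  fixes C :: "'a::euclidean_space set"
  assumes convex: "convex C"
    and compact: "compact C"
    and zero_interior: "0 \<in> interior C"
    and reflect: "x \<in> C \<Longrightarrow> - (x /\<^sub>R real DIM('a)) \<in> C"
begin

lemma zero_mem: "0 \<in> C"
  using zero_interior interior_subset by blast

lemma homothet_in_sets: "homothet r x C \<in> sets borel"
  using compact compact_homothet by (auto intro: borel_compact)

text \<open>The missing weight \<open>r - s - t\<close> goes to the origin, a point of
  \<open>C\<close>. Containments thus reduce to comparing sums of nonnegative coefficients.\<close>

lemma combination_mem:
  assumes "v \<in> C" "w \<in> C" "0 \<le> s" "0 \<le> t" "s + t \<le> r"
  shows "s *\<^sub>R v + t *\<^sub>R w \<in> homothet r 0 C"
proof (cases "r = 0")
  case True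
  then have "s = 0" "t = 0"
    using assms by linarith+
  then show ?thesis
    using True zero_mem by (auto simp: mem_homothet)
next
  case False
  then have r: "r > 0" using assms by linarith
  have "s / r + t / r \<le> 1"
    using assms r by (simp add: add_divide_distrib[symmetric])
  have "convex hull {0, v, w} \<subseteq> C"
    using assms zero_mem convex by (intro hull_minimal) auto
  moreover have "(s / r) *\<^sub>R v + (t / r) *\<^sub>R w \<in> convex hull {0, v, w}"
    unfolding convex_hull_3
    by (rule CollectI, rule exI[of _ "1 - s / r - t / r"], rule exI[of _ "s / r"],
        rule exI[of _ "t / r"]) (use assms r \<open>s / r + t / r \<le> 1\<close> in auto)
  ultimately have "(s / r) *\<^sub>R v + (t / r) *\<^sub>R w \<in> C"
    by blast
  moreover have "s *\<^sub>R v + t *\<^sub>R w = r *\<^sub>R ((s / r) *\<^sub>R v + (t / r) *\<^sub>R w) + 0"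
    using r by (simp add: scaleR_add_right)
  ultimately show ?thesis
    unfolding mem_homothet by blast
qed

lemma homothet_mono:
  assumes "0 \<le> r" "r \<le> s"
  shows "homothet r x C \<subseteq> homothet s x C"
proof
  fix p assume "p \<in> homothet r x C"
  then obtain v where v: "v \<in> C" "p = r *\<^sub>R v + x"
    by (auto simp: mem_homothet)
  show "p \<in> homothet s x C"
    using combination_mem[OF v(1) zero_mem, of r 0 s] assms v(2) by (auto simp: mem_homothet)
qed

lemma center_mem: "x \<in> homothet r x C"
  using zero_mem by (auto simp: mem_homothet intro!: bexI[of _ 0])

text \<open>By \<open>reflect\<close>, \<open>- w\<close> is d times a point of
  \<open>C\<close>.\<close>

lemma diff_mem:
  assumes "v \<in> C" "w \<in> C"
  shows "v - w \<in> homothet (real DIM('a) + 1) 0 C"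
  using combination_mem[OF assms(1) reflect[OF assms(2)], of 1 "real DIM('a)" "real DIM('a) + 1"]
  by simp

text \<open>If \<open>v\<^sub>1 = v\<^sub>2\<close>, then the second homothet is the image of the first under a homothety
  with centre \<open>p\<close>, a point of the first; so its centre lies in the first homothet.\<close>

lemma center_mem_of_close_directions:
  fixes r\<^sub>1 r\<^sub>2 :: real
  defines "n \<equiv> real DIM('a)"
  assumes v: "v\<^sub>1 \<in> C" "v\<^sub>2 \<in> C"
    and r: "0 < r\<^sub>1" "0 < r\<^sub>2" "r\<^sub>2 \<le> (1 + 1 / (2 * n)) * r\<^sub>1"
    and p: "p = r\<^sub>1 *\<^sub>R v\<^sub>1 + x\<^sub>1" "p = r\<^sub>2 *\<^sub>R v\<^sub>2 + x\<^sub>2"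
    and meet: "homothet (1 / (4 * (n + 1))) v\<^sub>1 C \<inter> homothet (1 / (4 * (n + 1))) v\<^sub>2 C \<noteq> {}"
  shows "x\<^sub>2 \<in> homothet r\<^sub>1 x\<^sub>1 C"
proof -
  have n: "n \<ge> 1"
    using DIM_positive[where 'a='a] by (simp add: n_def Suc_le_eq del: DIM_positive)
  \<comment> \<open>Here \<open>\<delta> * (n + 1) = 1 / 4\<close>, so by \<open>diff_mem\<close>
    overlapping copies force the difference of the two directions into \<open>C\<close> scaled by
    1/4.\<close>
  define \<delta> where "\<delta> = 1 / (4 * (n + 1))"
  obtain w\<^sub>1 w\<^sub>2 where w: "w\<^sub>1 \<in> C" "w\<^sub>2 \<in> C" "\<delta> *\<^sub>R w\<^sub>1 + v\<^sub>1 = \<delta> *\<^sub>R w\<^sub>2 + v\<^sub>2"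
    using meet unfolding \<delta>_def[symmetric] by (force simp: mem_homothet)
  obtain z where z: "z \<in> C" "w\<^sub>2 - w\<^sub>1 = (n + 1) *\<^sub>R z"
    using diff_mem[OF w(2,1)] by (auto simp: mem_homothet n_def)
  have "v\<^sub>1 - v\<^sub>2 = \<delta> *\<^sub>R (w\<^sub>2 - w\<^sub>1)"
    using w(3) by (simp add: algebra_simps)
  also have "\<dots> = (1 / 4) *\<^sub>R z"
    using n by (simp add: z(2) \<delta>_def)
  finally have d: "v\<^sub>1 - v\<^sub>2 = (1 / 4) *\<^sub>R z" .
  have "x\<^sub>2 - x\<^sub>1 = (r\<^sub>1 - r\<^sub>2) *\<^sub>R v\<^sub>1 + r\<^sub>2 *\<^sub>R (v\<^sub>1 - v\<^sub>2)"
    using p by (simp add: algebra_simps)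
  then have x: "x\<^sub>2 - x\<^sub>1 = (r\<^sub>1 - r\<^sub>2) *\<^sub>R v\<^sub>1 + (r\<^sub>2 / 4) *\<^sub>R z"
    by (simp add: d)
  \<comment> \<open>If \<open>r\<^sub>1 - r\<^sub>2\<close> is negative, \<open>v\<^sub>1\<close> is
    reflected at the cost of a factor \<open>n\<close>. The slack 1 + 1 / (2n) between the radii
    keeps that term at most \<open>r\<^sub>1 / 2\<close>, and \<open>r\<^sub>2 / 4\<close> is at
    most 3/8 of \<open>r\<^sub>1\<close>, so the coefficients still sum to at most
    \<open>r\<^sub>1\<close>.\<close>
  have "x\<^sub>2 - x\<^sub>1 \<in> homothet r\<^sub>1 0 C"
  proof (cases "r\<^sub>2 \<le> r\<^sub>1")
    case True
    show ?thesis
      unfolding x by (rule combination_mem) (use True r v z in auto)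
  next
    case False
    have "(r\<^sub>2 - r\<^sub>1) * n * inverse n = r\<^sub>2 - r\<^sub>1"
      using n by simp
    then have "((r\<^sub>2 - r\<^sub>1) * n) *\<^sub>R (- (v\<^sub>1 /\<^sub>R n)) = - ((r\<^sub>2 - r\<^sub>1) *\<^sub>R v\<^sub>1)"
      by (metis scaleR_minus_right scaleR_scaleR)
    also have "\<dots> = (r\<^sub>1 - r\<^sub>2) *\<^sub>R v\<^sub>1"
      by (simp add: scaleR_diff_left)
    finally have x': "x\<^sub>2 - x\<^sub>1 = ((r\<^sub>2 - r\<^sub>1) * n) *\<^sub>R (- (v\<^sub>1 /\<^sub>R n)) + (r\<^sub>2 / 4) *\<^sub>R z"
      using x by simp
    have "(r\<^sub>2 - r\<^sub>1) * n \<le> r\<^sub>1 / 2"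
      using r(3) n by (simp add: field_simps)
    moreover have "(1 + 1 / (2 * n)) * r\<^sub>1 \<le> (3 / 2) * r\<^sub>1"
      using n r(1) by (intro mult_right_mono) (auto simp: field_simps)
    then have "r\<^sub>2 \<le> (3 / 2) * r\<^sub>1"
      using r(3) by linarith
    ultimately have "(r\<^sub>2 - r\<^sub>1) * n + r\<^sub>2 / 4 \<le> r\<^sub>1"
      using r(1) by linarith
    moreover have "- (v\<^sub>1 /\<^sub>R n) \<in> C"
      using reflect[OF v(1)] by (simp only: n_def)
    ultimately show ?thesis
      unfolding x' using z(1) False r(2) n by (intro combination_mem) auto
  qed
  then show ?thesis
    by (auto simp: mem_homothet diff_eq_eq)
qed

text \<open>A volume comparison: the disjoint copies all lie in \<open>C\<close> scaled by
  \<open>1 + \<delta>\<close>, and \<open>C\<close> has positive volume because its interior is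
  nonempty.\<close>

lemma card_disjoint_copies_le:
  fixes \<delta> :: real
  assumes "finite V" "V \<subseteq> C" "\<delta> > 0"
    and disj: "disjoint_family_on (\<lambda>v. homothet \<delta> v C) V"
  shows "real (card V) \<le> ((1 + \<delta>) / \<delta>) ^ DIM('a)"
proof -
  define vol where "vol = measure lebesgue C"
  have meas: "homothet r x C \<in> lmeasurable" for r x
    using compact compact_homothet lmeasurable_compact by blast
  have vol: "measure lebesgue (homothet r x C) = r ^ DIM('a) * vol" if "r \<ge> 0" for r x
    unfolding homothet_def vol_def measure_lebesgue_affine using that by simp
  have "\<not> negligible C"
    using zero_interior interior_subset open_interior
    by (metis empty_iff negligible_subset open_not_negligible)
  then have "vol > 0"
    unfolding vol_def
    by (metis compact lmeasurable_compact measure_nonneg negligible_iff_measure order_le_less)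
  have "real (card V) * (\<delta> ^ DIM('a) * vol) = (\<Sum>v\<in>V. measure lebesgue (homothet \<delta> v C))"
    using assms by (simp add: vol)
  also have "\<dots> = measure lebesgue (\<Union>v\<in>V. homothet \<delta> v C)"
  proof (rule measure_finite_Union[symmetric])
    show "(\<lambda>v. homothet \<delta> v C) ` V \<subseteq> sets lebesgue"
      using meas fmeasurableD by blast
    show "emeasure lebesgue (homothet \<delta> v C) \<noteq> \<infinity>" for v
      using fmeasurableD2[OF meas] by simp
  qed (use assms in auto)
  also have "\<dots> \<le> measure lebesgue (homothet (1 + \<delta>) 0 C)"
  proof (rule measure_mono_fmeasurable)
    show "(\<Union>v\<in>V. homothet \<delta> v C) \<subseteq> homothet (1 + \<delta>) 0 C"
    proof safe
      fix v p assume "v \<in> V" "p \<in> homothet \<delta> v C"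
      then obtain u where "u \<in> C" "p = \<delta> *\<^sub>R u + v"
        by (auto simp: mem_homothet)
      then show "p \<in> homothet (1 + \<delta>) 0 C"
        using combination_mem[of u v \<delta> 1 "1 + \<delta>"] assms \<open>v \<in> V\<close> by auto
    qed
  qed (use meas assms fmeasurableD in auto)
  also have "\<dots> = (1 + \<delta>) ^ DIM('a) * vol"
    using assms by (simp add: vol)
  finally show ?thesis
    using \<open>vol > 0\<close> assms(3) by (simp add: power_divide field_simps)
qed

text \<open>The relation is not symmetric: \<open>x\<close> plays the centre chosen first,
  \<open>y\<close> a later one, not yet covered and with a radius that exceeds that of
  \<open>x\<close> by at most the greedy slack.\<close>

definition separated :: "('a \<Rightarrow> real) \<Rightarrow> 'a \<Rightarrow> 'a \<Rightarrow> bool" where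
  "separated r x y \<longleftrightarrow>
     r y \<le> (1 + 1 / (2 * real DIM('a))) * r x \<and> y \<notin> homothet (r x) x C"

text \<open>Each homothet containing \<open>p\<close> yields the direction \<open>v x\<close> from
  its centre to \<open>p\<close>. If the small copies of \<open>C\<close> at two directions met, one
  centre would lie in the other homothet, against separation; so the copies are disjoint and the
  volume bound applies.\<close>

lemma multiplicity_le:
  assumes "finite X" and pos: "\<And>x. x \<in> X \<Longrightarrow> r x > 0"
    and sep: "\<And>x y. \<lbrakk>x \<in> X; y \<in> X; x \<noteq> y\<rbrakk> \<Longrightarrow> separated r x y \<or> separated r y x"
  shows "card {x \<in> X. p \<in> homothet (r x) x C} \<le> (4 * DIM('a) + 5) ^ DIM('a)"
proof -
  define n where "n = real DIM('a)"
  define \<delta> where "\<delta> = 1 / (4 * (n + 1))"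
  have n: "n > 0" "\<delta> > 0" by (auto simp: n_def \<delta>_def)
  define Z where "Z = {x \<in> X. p \<in> homothet (r x) x C}"
  define v where "v x = (p - x) /\<^sub>R r x" for x
  have v: "v x \<in> C" "p = r x *\<^sub>R v x + x" if "x \<in> Z" for x
  proof -
    obtain u where u: "u \<in> C" "p = r x *\<^sub>R u + x" "r x > 0"
      using \<open>x \<in> Z\<close> pos by (auto simp: Z_def mem_homothet)
    then have "v x = u"
      by (simp add: v_def)
    then show "v x \<in> C" "p = r x *\<^sub>R v x + x"
      using u by auto
  qed
  have disj: "homothet \<delta> (v x) C \<inter> homothet \<delta> (v y) C = {}"
    if xy: "x \<in> Z" "y \<in> Z" "x \<noteq> y" for x y
  proof -
    have *: "homothet \<delta> (v x) C \<inter> homothet \<delta> (v y) C = {}"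
      if "x \<in> Z" "y \<in> Z" "separated r x y" for x y
    proof (rule ccontr)
      assume "homothet \<delta> (v x) C \<inter> homothet \<delta> (v y) C \<noteq> {}"
      then have "y \<in> homothet (r x) x C"
        using that pos unfolding \<delta>_def n_def separated_def Z_def
        by (intro center_mem_of_close_directions[OF v(1)[OF that(1)] v(1)[OF that(2)] _ _ _
              v(2)[OF that(1)] v(2)[OF that(2)]]) auto
      then show False
        using that by (simp add: separated_def)
    qed
    show ?thesis
      using sep[of x y] xy *[of x y] *[of y x] by (auto simp: Z_def)
  qed
  \<comment> \<open>Equal directions would give equal copies, which are nonempty and so not
    disjoint.\<close>
  have inj: "inj_on v Z"
  proof (rule inj_onI, rule ccontr)
    fix x y assume "x \<in> Z" "y \<in> Z" "v x = v y" "x \<noteq> y"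
    then show False
      using disj[of x y] center_mem[of "v x" \<delta>] by auto
  qed
  have "real (card (v ` Z)) \<le> ((1 + \<delta>) / \<delta>) ^ DIM('a)"
  proof (rule card_disjoint_copies_le)
    show "disjoint_family_on (\<lambda>v. homothet \<delta> v C) (v ` Z)"
      using disj by (fastforce simp: disjoint_family_on_def)
  qed (use v(1) n assms(1) in \<open>auto simp: Z_def\<close>)
  also have "(1 + \<delta>) / \<delta> = 4 * n + 5"
    using n by (simp add: \<delta>_def field_simps)
  finally have "real (card Z) \<le> real ((4 * DIM('a) + 5) ^ DIM('a))"
    using inj by (simp add: card_image n_def add.commute)
  then show ?thesis
    unfolding Z_def by linarith
qed

end

section \<open>Comparison of homothets with balls, and their behaviour under change of scale\<close>

context centred_body
begin

lemma cball_subset_homothet: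
  obtains e where "e > 0" "\<And>r x. r > 0 \<Longrightarrow> cball x (r * e) \<subseteq> homothet r x C"
proof -
  obtain e where e: "e > 0" "cball 0 e \<subseteq> C"
    using zero_interior mem_interior_cball by blast
  have "cball x (r * e) \<subseteq> homothet r x C" if "r > 0" for r x
  proof
    fix p assume "p \<in> cball x (r * e)"
    then have "norm (p - x) / r \<le> e"
      using that by (simp add: dist_norm norm_minus_commute pos_divide_le_eq mult.commute)
    then have "(p - x) /\<^sub>R r \<in> cball 0 e"
      using that by (simp add: divide_inverse_commute)
    then have "(p - x) /\<^sub>R r \<in> C"
      using e(2) by blast
    moreover have "p = r *\<^sub>R ((p - x) /\<^sub>R r) + x"
      using that by simp
    ultimately show "p \<in> homothet r x C"
      unfolding mem_homothet by blast
  qed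
  then show thesis
    using that e(1) by blast
qed

lemma homothet_subset_cball:
  obtains b where "b > 0" "\<And>r x. r > 0 \<Longrightarrow> homothet r x C \<subseteq> cball x (r * b)"
proof -
  obtain b where b: "b > 0" "\<And>v. v \<in> C \<Longrightarrow> norm v \<le> b"
    using compact_imp_bounded[OF compact] bounded_pos by blast
  have "homothet r x C \<subseteq> cball x (r * b)" if "r > 0" for r x
    using b(2) that by (auto simp: mem_homothet dist_norm)
  then show thesis
    using that b(1) by blast
qed

text \<open>By compactness, the points of \<open>C\<close> representing \<open>p\<close> at the
  scales above \<open>s\<close> have a limit point in \<open>C\<close>, which represents
  \<open>p\<close> at scale \<open>s\<close>. This yields continuity of the measure from the right,
  also at \<open>s = 0\<close>.\<close>

lemma Inter_homothet_decreasing: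
  assumes "s \<ge> 0"
  shows "(\<Inter>n::nat. homothet (s + inverse (real (Suc n))) x C) = homothet s x C"
proof (intro equalityI subsetI)
  fix p assume "p \<in> (\<Inter>n::nat. homothet (s + inverse (real (Suc n))) x C)"
  then have "\<forall>n. \<exists>v\<in>C. p = (s + inverse (real (Suc n))) *\<^sub>R v + x"
    by (auto simp: mem_homothet)
  then obtain v where v: "\<And>n. v n \<in> C" "\<And>n. p = (s + inverse (real (Suc n))) *\<^sub>R v n + x"
    by metis
  obtain l h where l: "l \<in> C" "strict_mono h" "(v \<circ> h) \<longlonglongrightarrow> l"
    using compact v(1) unfolding compact_def by blast
  have "(\<lambda>n. (s + inverse (real (Suc (h n)))) *\<^sub>R (v \<circ> h) n + x) \<longlonglongrightarrow> (s + 0) *\<^sub>R l + x"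
    using LIMSEQ_subseq_LIMSEQ[OF LIMSEQ_inverse_real_of_nat l(2)] l(3)
    by (intro tendsto_intros) (auto simp: o_def)
  moreover have "(s + inverse (real (Suc (h n)))) *\<^sub>R (v \<circ> h) n + x = p" for n
    using v(2)[of "h n"] by simp
  ultimately have "p = s *\<^sub>R l + x"
    using LIMSEQ_unique tendsto_const by fastforce
  then show "p \<in> homothet s x C"
    using l(1) by (auto simp: mem_homothet)
next
  fix p assume "p \<in> homothet s x C"
  then show "p \<in> (\<Inter>n::nat. homothet (s + inverse (real (Suc n))) x C)"
    using homothet_mono[OF assms, of "s + inverse (real (Suc n))" x for n] by fastforce
qed

text \<open>An interior point \<open>v\<close> of \<open>C\<close> can be pushed outwards by a
  factor 1 + 1 / (n + 1) without leaving \<open>C\<close>; the scale (n + 1) / (n + 2) undoes the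
  push. Only the frontier can escape the union, so a null frontier gives continuity of the measure
  from the left.\<close>

lemma interior_homothet_subset_Union:
  assumes "s > 0"
  shows "interior (homothet s x C) \<subseteq> (\<Union>n::nat. homothet (s * (real (Suc n) / real (Suc (Suc n)))) x C)"
proof
  fix p assume "p \<in> interior (homothet s x C)"
  then obtain v where v: "v \<in> interior C" "p = s *\<^sub>R v + x"
    using interior_homothet[OF assms, of x C] by (auto simp: mem_homothet)
  obtain e where e: "e > 0" "cball v e \<subseteq> C"
    using v(1) mem_interior_cball by blast
  obtain n :: nat where n: "norm v / e < real n"
    using reals_Archimedean2 by blast
  then have "norm v \<le> e * real (Suc n)"
    using e(1) by (simp add: field_simps)
  then have "norm (v /\<^sub>R real (Suc n)) \<le> e"
    by (simp add: field_simps)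
  then have "v + v /\<^sub>R real (Suc n) \<in> C"
    using e(2) by (auto simp: dist_norm)
  moreover have "(s * (real (Suc n) / real (Suc (Suc n)))) *\<^sub>R (v + v /\<^sub>R real (Suc n)) = s *\<^sub>R v"
  proof -
    have "v + v /\<^sub>R real (Suc n) = (1 + 1 / real (Suc n)) *\<^sub>R v"
      by (simp add: scaleR_add_left divide_inverse)
    moreover have "a / (a + 1) * (1 + 1 / a) = 1" if "a > 0" for a :: real
      using that by (simp add: divide_simps)
    then have "real (Suc n) / (real (Suc n) + 1) * (1 + 1 / real (Suc n)) = 1"
      by (metis of_nat_0_less_iff zero_less_Suc)
    then have "real (Suc n) / real (Suc (Suc n)) * (1 + 1 / real (Suc n)) = 1"
      by (metis of_nat_Suc add.commute)
    ultimately show ?thesis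
      by (simp only: scaleR_scaleR mult.assoc mult_1_right)
  qed
  ultimately show "p \<in> (\<Union>n::nat. homothet (s * (real (Suc n) / real (Suc (Suc n)))) x C)"
    using v(2) by (auto simp: mem_homothet intro!: exI[of _ n] bexI[of _ "v + v /\<^sub>R real (Suc n)"])
qed

text \<open>Some frontier point of the bounded set \<open>C\<close> is moved to \<open>x\<close>.
  Non-degeneracy then makes single points null.\<close>

lemma mem_frontier_translate:
  obtains y where "x \<in> frontier (homothet 1 y C)"
proof -
  have "C \<noteq> UNIV"
    using compact_imp_bounded[OF compact] not_bounded_UNIV by metis
  then obtain z where "z \<in> frontier C"
    using zero_mem frontier_not_empty[of C] by blast
  moreover have "homothet 1 (x - z) C = (+) (x - z) ` C"
    by (simp add: homothet_def add.commute)
  ultimately have "x \<in> frontier (homothet 1 (x - z) C)"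
    using frontier_translation[of "x - z" C] by (auto intro!: image_eqI[of _ _ z])
  then show thesis using that by blast
qed

end

section \<open>Homothets of prescribed measure\<close>

text \<open>The prescribed measure \<open>m\<close> is a parameter of its own: it will be the
  measure of the original body, whereas \<open>C\<close> here will be a translate of that
  body.\<close>

locale centred_body_measure = centred_body C for C :: "'a::euclidean_space set" +
  fixes \<mu> :: "'a measure" and m :: ennreal
  assumes lf: "locally_finite_borel \<mu>"
    and nondeg: "non_degenerate \<mu> C"
    and infinite: "emeasure \<mu> UNIV = \<infinity>"
    and m_pos: "0 < m" and m_fin: "m < \<infinity>"
begin

lemma sets_eq [measurable_cong]: "sets \<mu> = sets borel"
  using lf by (simp add: locally_finite_borel_def)

lemma emeasure_bounded_finite:
  assumes "bounded S"
  shows "emeasure \<mu> S < \<infinity>"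
proof -
  have "emeasure \<mu> S \<le> emeasure \<mu> (closure S)"
    by (rule emeasure_mono) (auto simp: closure_subset sets_eq)
  also have "\<dots> < \<infinity>"
    using lf assms unfolding locally_finite_borel_def by (simp add: compact_closure)
  finally show ?thesis .
qed

lemma homothet_sets: "homothet r x C \<in> sets \<mu>"
  using homothet_in_sets sets_eq by blast

lemma emeasure_homothet_finite: "emeasure \<mu> (homothet r x C) < \<infinity>"
  using emeasure_bounded_finite compact compact_homothet compact_imp_bounded by blast

lemma emeasure_singleton: "emeasure \<mu> {x} = 0"
proof -
  obtain y where y: "x \<in> frontier (homothet 1 y C)"
    using mem_frontier_translate by blast
  have "emeasure \<mu> {x} \<le> emeasure \<mu> (frontier (homothet 1 y C))"
    by (rule emeasure_mono) (use y in \<open>auto simp: sets_eq\<close>)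
  also have "\<dots> = 0"
    using nondeg by (simp add: non_degenerate_def)
  finally show ?thesis by simp
qed

lemma exists_ball_emeasure_gt:
  assumes "a < \<infinity>"
  obtains k where "k > 0" "a < emeasure \<mu> (ball (0 :: 'a) k)"
proof -
  have "(SUP n. emeasure \<mu> (ball 0 (real n))) = emeasure \<mu> (\<Union>n. ball 0 (real n))"
    by (rule SUP_emeasure_incseq) (auto simp: sets_eq incseq_def)
  also have "(\<Union>n. ball 0 (real n)) = (UNIV :: 'a set)"
    using reals_Archimedean2 by auto
  finally have "(SUP n. emeasure \<mu> (ball 0 (real n))) = \<infinity>"
    using infinite by simp
  then have "a < (SUP n. emeasure \<mu> (ball 0 (real n)))"
    using assms by metis
  then obtain n where n: "a < emeasure \<mu> (ball 0 (real n))"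
    by (auto simp: less_SUP_iff)
  then have "real n > 0"
    by (cases n) auto
  then show thesis using that n by blast
qed

text \<open>An intermediate value argument: \<open>s\<close> is the infimum of the radii with
  measure at least \<open>m\<close>. Continuity from the right gives \<open>m \<le> f s\<close>,
  continuity from the left the converse.\<close>

lemma exists_radius: "\<exists>r>0. emeasure \<mu> (homothet r x C) = m"
proof -
  define f where "f r = emeasure \<mu> (homothet r x C)" for r
  have mono: "f r \<le> f s" if "0 \<le> r" "r \<le> s" for r s
    unfolding f_def using homothet_mono[OF that] homothet_sets by (rule emeasure_mono)
  define A where "A = {r. 0 \<le> r \<and> m \<le> f r}"
  define s where "s = Inf A"
  obtain e where e: "e > 0" "\<And>r x. r > 0 \<Longrightarrow> cball x (r * e) \<subseteq> homothet r x C"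
    using cball_subset_homothet by blast
  obtain k where k: "k > 0" "m < emeasure \<mu> (ball 0 k)"
    using exists_ball_emeasure_gt m_fin by blast
  \<comment> \<open>At this radius the inscribed ball around \<open>x\<close> already contains
    \<open>ball 0 k\<close>, whose measure exceeds \<open>m\<close>.\<close>
  define R where "R = (k + norm x) / e"
  have R: "R > 0" "R * e = k + norm x"
    using k e by (auto simp: R_def add_pos_nonneg)
  have "(ball 0 k :: 'a set) \<subseteq> cball x (R * e)"
  proof
    fix y :: 'a assume "y \<in> ball 0 k"
    then show "y \<in> cball x (R * e)"
      using norm_triangle_ineq4[of x y] by (simp add: R dist_norm)
  qed
  also have "\<dots> \<subseteq> homothet R x C"
    using e R by blast
  finally have "emeasure \<mu> (ball 0 k) \<le> f R"
    unfolding f_def using homothet_sets by (rule emeasure_mono)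
  then have "R \<in> A"
    using k R by (auto simp: A_def)
  have bdd: "bdd_below A"
    by (auto simp: A_def bdd_below_def)
  have s: "s \<ge> 0"
    unfolding s_def using \<open>R \<in> A\<close> by (intro cInf_greatest) (auto simp: A_def)
  have "m \<le> (INF n. f (s + inverse (real (Suc n))))"
  proof (rule INF_greatest)
    fix n :: nat
    have "s < s + inverse (real (Suc n))" by simp
    then obtain a where "a \<in> A" "a < s + inverse (real (Suc n))"
      using cInf_less_iff[OF _ bdd] \<open>R \<in> A\<close> unfolding s_def by blast
    then show "m \<le> f (s + inverse (real (Suc n)))"
      using mono[of a "s + inverse (real (Suc n))"] by (auto simp: A_def)
  qed
  also have "\<dots> = emeasure \<mu> (\<Inter>n::nat. homothet (s + inverse (real (Suc n))) x C)"
    unfolding f_def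
  proof (rule INF_emeasure_decseq)
    show "decseq (\<lambda>n. homothet (s + inverse (real (Suc n))) x C)"
      using s unfolding decseq_def by (intro allI impI homothet_mono) (auto simp: field_simps)
    show "emeasure \<mu> (homothet (s + inverse (real (Suc n))) x C) \<noteq> \<infinity>" for n
      using emeasure_homothet_finite by (simp add: less_top)
  qed (use homothet_sets in auto)
  also have "\<dots> = f s"
    unfolding f_def using Inter_homothet_decreasing[OF s] by simp
  finally have ge: "m \<le> f s" .
  \<comment> \<open>Continuity from the left needs a positive scale; \<open>s = 0\<close> is
    excluded because points are null and \<open>m\<close> is positive.\<close>
  have "f 0 \<le> emeasure \<mu> {x}"
    unfolding f_def by (rule emeasure_mono) (auto simp: mem_homothet sets_eq)
  then have "f 0 = 0"
    by (simp add: emeasure_singleton)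
  then have "s > 0"
    using s ge m_pos by (cases "s = 0") auto
  define t where "t n = s * (real (Suc n) / real (Suc (Suc n)))" for n
  have t: "0 \<le> t n" "t n < s" for n
    using \<open>s > 0\<close> by (auto simp: t_def field_simps)
  have lt: "f (t n) \<le> m" for n
  proof (rule ccontr)
    assume "\<not> f (t n) \<le> m"
    then have "t n \<in> A"
      using t by (auto simp: A_def)
    then have "s \<le> t n"
      unfolding s_def using bdd by (rule cInf_lower)
    then show False using t[of n] by simp
  qed
  have "f s \<le> emeasure \<mu> ((\<Union>n. homothet (t n) x C) \<union> frontier (homothet s x C))"
    unfolding f_def
  proof (rule emeasure_mono)
    have "homothet s x C \<subseteq> interior (homothet s x C) \<union> frontier (homothet s x C)"
      using closure_subset by (auto simp: frontier_def)
    then show "homothet s x C \<subseteq> (\<Union>n. homothet (t n) x C) \<union> frontier (homothet s x C)"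
      using interior_homothet_subset_Union[OF \<open>s > 0\<close>, of x] unfolding t_def by blast
  qed (use homothet_sets sets_eq in \<open>auto intro!: sets.Un\<close>)
  also have "\<dots> \<le> emeasure \<mu> (\<Union>n. homothet (t n) x C) + emeasure \<mu> (frontier (homothet s x C))"
    using homothet_sets sets_eq by (intro emeasure_subadditive) auto
  also have "\<dots> = emeasure \<mu> (\<Union>n. homothet (t n) x C)"
    using nondeg \<open>s > 0\<close> by (simp add: non_degenerate_def)
  also have "\<dots> = (SUP n. f (t n))"
    unfolding f_def
  proof (rule SUP_emeasure_incseq[symmetric])
    have "t i \<le> t j" if "i \<le> j" for i j
      unfolding t_def using \<open>s > 0\<close> that by (intro mult_left_mono) (auto simp: field_simps)
    then show "incseq (\<lambda>n. homothet (t n) x C)"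
      unfolding incseq_def using t by (intro allI impI homothet_mono) auto
  qed (use homothet_sets in auto)
  also have "\<dots> \<le> m"
    using lt by (rule SUP_least)
  finally show ?thesis
    using ge \<open>s > 0\<close> unfolding f_def by (intro exI[of _ s]) auto
qed

lemma exists_ball_emeasure_less: "\<exists>e>0. emeasure \<mu> (ball x e) < m"
proof -
  have "(INF n. emeasure \<mu> (ball x (inverse (real (Suc n)))))
      = emeasure \<mu> (\<Inter>n. ball x (inverse (real (Suc n))))"
  proof (rule INF_emeasure_decseq)
    show "decseq (\<lambda>n. ball x (inverse (real (Suc n))))"
      unfolding decseq_def by (intro allI impI subset_ball) (auto simp: field_simps)
    show "emeasure \<mu> (ball x (inverse (real (Suc n)))) \<noteq> \<infinity>" for n
      using emeasure_bounded_finite[OF bounded_ball] by (simp add: less_top)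
  qed (auto simp: sets_eq)
  also have "(\<Inter>n. ball x (inverse (real (Suc n)))) = {x}"
  proof (intro equalityI subsetI)
    fix y assume y: "y \<in> (\<Inter>n. ball x (inverse (real (Suc n))))"
    show "y \<in> {x}"
    proof (rule ccontr)
      assume "y \<notin> {x}"
      then have "dist x y > 0" by auto
      then obtain n where "inverse (real (Suc n)) < dist x y"
        using reals_Archimedean by blast
      moreover have "dist x y < inverse (real (Suc n))"
        using y by (metis INT_D UNIV_I mem_ball)
      ultimately show False by simp
    qed
  qed auto
  finally have "(INF n. emeasure \<mu> (ball x (inverse (real (Suc n))))) < m"
    using emeasure_singleton m_pos by simp
  then obtain n where "emeasure \<mu> (ball x (inverse (real (Suc n)))) < m"
    by (auto simp: INF_less_iff)
  then show ?thesis
    by (intro exI[of _ "inverse (real (Suc n))"]) auto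
qed

section \<open>Bounds for the radii over a bounded set of centres\<close>

context
  fixes r :: "'a \<Rightarrow> real"
  assumes radius: "\<And>x. r x > 0" "\<And>x. emeasure \<mu> (homothet (r x) x C) = m"
begin

text \<open>A homothet with too large a radius would swallow a fixed ball of measure above
  \<open>m\<close>.\<close>

lemma radius_bounded_above:
  assumes "bounded K"
  obtains R where "\<And>x. x \<in> K \<Longrightarrow> r x \<le> R"
proof -
  obtain e where e: "e > 0" "\<And>r x. r > 0 \<Longrightarrow> cball x (r * e) \<subseteq> homothet r x C"
    using cball_subset_homothet by blast
  obtain k where k: "k > 0" "m < emeasure \<mu> (ball 0 k)"
    using exists_ball_emeasure_gt m_fin by blast
  obtain B where B: "\<And>x. x \<in> K \<Longrightarrow> norm x \<le> B"
    using assms bounded_iff by metis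
  have "r x \<le> (k + B) / e" if "x \<in> K" for x
  proof (rule ccontr)
    assume "\<not> r x \<le> (k + B) / e"
    then have "k + B < r x * e"
      using e(1) by (simp add: field_simps)
    have "(ball 0 k :: 'a set) \<subseteq> cball x (r x * e)"
    proof
      fix y :: 'a assume "y \<in> ball 0 k"
      then show "y \<in> cball x (r x * e)"
        using norm_triangle_ineq4[of x y] B[OF that] \<open>k + B < r x * e\<close> by (simp add: dist_norm)
    qed
    also have "\<dots> \<subseteq> homothet (r x) x C"
      using e radius by blast
    finally have "emeasure \<mu> (ball 0 k) \<le> emeasure \<mu> (homothet (r x) x C)"
      using homothet_sets by (rule emeasure_mono)
    then show False
      using k(2) radius(2) by (metis not_le)
  qed
  then show thesis using that by blast
qed

text \<open>Open sets of measure below \<open>m\<close> cover the compact closure of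
  \<open>K\<close>. A homothet small against a Lebesgue number \<open>\<epsilon>\<close> of this
  cover would lie in one of them.\<close>

lemma radius_bounded_below:
  assumes "bounded K"
  obtains \<rho> where "\<rho> > 0" "\<And>x. x \<in> K \<Longrightarrow> \<rho> \<le> r x"
proof -
  obtain b where b: "b > 0" "\<And>r x. r > 0 \<Longrightarrow> homothet r x C \<subseteq> cball x (r * b)"
    using homothet_subset_cball by blast
  have "closure K \<subseteq> \<Union>{G. open G \<and> emeasure \<mu> G < m}"
  proof
    fix x
    obtain e where "e > 0" "emeasure \<mu> (ball x e) < m"
      using exists_ball_emeasure_less by blast
    then show "x \<in> \<Union>{G. open G \<and> emeasure \<mu> G < m}"
      by (intro UnionI[of "ball x e"]) auto
  qed
  then obtain \<epsilon> where \<epsilon>: "0 < \<epsilon>"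
    "\<And>x. x \<in> closure K \<Longrightarrow> \<exists>G \<in> {G. open G \<and> emeasure \<mu> G < m}. ball x \<epsilon> \<subseteq> G"
    using assms Heine_Borel_lemma[of "closure K" "{G. open G \<and> emeasure \<mu> G < m}"]
    unfolding compact_closure[symmetric] by (metis (no_types, lifting) mem_Collect_eq)
  have "\<epsilon> / b \<le> r x" if "x \<in> K" for x
  proof (rule ccontr)
    assume "\<not> \<epsilon> / b \<le> r x"
    then have "r x * b < \<epsilon>"
      using b(1) by (simp add: field_simps)
    have "x \<in> closure K"
      using that closure_subset by blast
    then obtain G where G: "open G" "emeasure \<mu> G < m" "ball x \<epsilon> \<subseteq> G"
      using \<epsilon>(2) by auto
    have "homothet (r x) x C \<subseteq> cball x (r x * b)"
      using b(2) radius(1) by blast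
    also have "\<dots> \<subseteq> ball x \<epsilon>"
      using \<open>r x * b < \<epsilon>\<close> by auto
    also have "\<dots> \<subseteq> G" by fact
    finally have "emeasure \<mu> (homothet (r x) x C) \<le> emeasure \<mu> G"
      by (rule emeasure_mono) (use G sets_eq in auto)
    then show False
      using radius(2) G(2) by (metis not_le)
  qed
  then show thesis
    using that[of "\<epsilon> / b"] \<epsilon>(1) b(1) by auto
qed

end

end

section \<open>Coverings of bounded sets with bounded multiplicity\<close>

text \<open>Finitely many balls of radius \<open>d / 2\<close> cover the set, and none holds two of
  the separated points.\<close>

lemma bounded_imp_card_separated_le:
  fixes K :: "'a::euclidean_space set"
  assumes "bounded K" "d > 0"
  obtains N where
    "\<And>X. \<lbrakk>X \<subseteq> K; \<And>x y. \<lbrakk>x \<in> X; y \<in> X; x \<noteq> y\<rbrakk> \<Longrightarrow> d \<le> dist x y\<rbrakk> \<Longrightarrow> card X \<le> N"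
proof -
  obtain T where T: "finite T" "closure K \<subseteq> (\<Union>t\<in>T. ball t (d / 2))"
    using assms compact_closure[of K] unfolding compact_eq_totally_bounded
    by (meson half_gt_zero)
  have "card X \<le> card T"
    if X: "X \<subseteq> K" "\<And>x y. \<lbrakk>x \<in> X; y \<in> X; x \<noteq> y\<rbrakk> \<Longrightarrow> d \<le> dist x y" for X
  proof -
    have "\<forall>x\<in>X. \<exists>t\<in>T. dist t x < d / 2"
      using X(1) T(2) closure_subset by (fastforce simp: subset_iff)
    then obtain g where g: "\<And>x. x \<in> X \<Longrightarrow> g x \<in> T" "\<And>x. x \<in> X \<Longrightarrow> dist (g x) x < d / 2"
      by metis
    have "inj_on g X"
    proof (rule inj_onI, rule ccontr)
      fix x y assume xy: "x \<in> X" "y \<in> X" "g x = g y" "x \<noteq> y"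
      then have "dist x y < d"
        using g(2)[of x] g(2)[of y] dist_triangle3[of x y "g x"] by simp
      then show False
        using X(2)[of x y] xy by simp
    qed
    then show ?thesis
      using g(1) T(1) by (intro card_inj_on_le[of g]) auto
  qed
  then show thesis using that by blast
qed

context centred_body
begin

lemma separated_dist_ge:
  assumes "0 < \<rho>" "\<rho> \<le> r x" "separated r x y" "cball x (r x * e) \<subseteq> homothet (r x) x C" "e > 0"
  shows "\<rho> * e \<le> dist x y"
proof -
  have "y \<notin> cball x (r x * e)"
    using assms by (auto simp: separated_def)
  moreover have "\<rho> * e \<le> r x * e"
    using assms by simp
  ultimately show ?thesis by simp
qed

text \<open>The greedy selection is replaced by an extremal choice: cardinalities of
  \<open>good\<close> sets are bounded by packing, and one of greatest cardinality must cover
  \<open>K\<close>, since otherwise a further centre could be added.\<close>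

lemma exists_separated_cover:
  assumes "bounded K" and pos: "0 < \<rho>" "\<And>x. x \<in> K \<Longrightarrow> \<rho> \<le> r x" and R: "\<And>x. x \<in> K \<Longrightarrow> r x \<le> R"
  shows "\<exists>X. finite X \<and> X \<subseteq> K \<and> K \<subseteq> (\<Union>x\<in>X. homothet (r x) x C)
    \<and> (\<forall>x\<in>X. \<forall>y\<in>X. x \<noteq> y \<longrightarrow> separated r x y \<or> separated r y x)"
proof -
  define q where "q = 1 + 1 / (2 * real DIM('a))"
  have q: "q > 1" by (simp add: q_def)
  define U where "U X = K - (\<Union>x\<in>X. homothet (r x) x C)" for X
  \<comment> \<open>The last conjunct is the greedy invariant: no uncovered point has a radius above
    \<open>q\<close> times a chosen one. It makes any new uncovered centre separated from the old
    ones.\<close>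
  define good where "good X \<longleftrightarrow> finite X \<and> X \<subseteq> K
    \<and> (\<forall>x\<in>X. \<forall>y\<in>X. x \<noteq> y \<longrightarrow> separated r x y \<or> separated r y x)
    \<and> (\<forall>x\<in>X. \<forall>y\<in>U X. r y \<le> q * r x)" for X
  obtain e where e: "e > 0" "\<And>r x. r > 0 \<Longrightarrow> cball x (r * e) \<subseteq> homothet r x C"
    using cball_subset_homothet by blast
  have rpos: "r x > 0" if "x \<in> K" for x
    using pos that by force
  obtain N where N: "\<And>X. \<lbrakk>X \<subseteq> K; \<And>x y. \<lbrakk>x \<in> X; y \<in> X; x \<noteq> y\<rbrakk> \<Longrightarrow> \<rho> * e \<le> dist x y\<rbrakk> \<Longrightarrow> card X \<le> N"
    using bounded_imp_card_separated_le[OF assms(1), of "\<rho> * e"] pos e(1) by (metis mult_pos_pos)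
  have bound: "card X \<le> N" if "good X" for X
  proof (rule N)
    show "X \<subseteq> K" using that by (simp add: good_def)
    fix x y assume xy: "x \<in> X" "y \<in> X" "x \<noteq> y"
    then have "x \<in> K" "y \<in> K" "separated r x y \<or> separated r y x"
      using that by (auto simp: good_def)
    moreover have "\<rho> * e \<le> dist a b" if "a \<in> K" "separated r a b" for a b
      using separated_dist_ge[OF pos(1) pos(2)[OF that(1)] that(2) e(2)[OF rpos[OF that(1)]] e(1)] .
    ultimately show "\<rho> * e \<le> dist x y"
      by (metis dist_commute)
  qed
  have "good {}" by (simp add: good_def)
  moreover have "\<forall>X. good X \<longrightarrow> card X < Suc N"
    using bound by (simp add: less_Suc_eq_le)
  ultimately have "\<exists>X. good X \<and> (\<forall>Y. good Y \<longrightarrow> card Y \<le> card X)"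
    by (rule ex_has_greatest_nat)
  then obtain X where X: "good X" "\<And>Y. good Y \<Longrightarrow> card Y \<le> card X"
    by metis
  have "U X = {}"
  proof (rule ccontr)
    assume ne: "U X \<noteq> {}"
    have UK: "U X \<subseteq> K" by (auto simp: U_def)
    \<comment> \<open>The supremum of the uncovered radii need not be attained; a centre with radius
      above \<open>S / q\<close> is enough to preserve the invariant, which is why the slack
      \<open>q > 1\<close> is built in.\<close>
    define S where "S = Sup (r ` U X)"
    have bdd: "bdd_above (r ` U X)"
      using R UK by (intro bdd_aboveI[of _ R]) auto
    have le_S: "r y \<le> S" if "y \<in> U X" for y
      unfolding S_def using that bdd by (intro cSup_upper) auto
    obtain y0 where "y0 \<in> U X" using ne by blast
    then have "S > 0"
      using le_S[of y0] rpos UK by force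
    then have "S / q < S"
      using q by (simp add: field_simps)
    then obtain y where y: "y \<in> U X" "S / q < r y"
      using less_cSup_iff[OF _ bdd, of "S / q"] ne unfolding S_def by auto
    have "y \<notin> X"
      using y(1) center_mem by (auto simp: U_def)
    have "good (insert y X)"
      unfolding good_def
    proof (intro conjI ballI impI)
      have sep: "separated r x y" if "x \<in> X" for x
        using that y X(1) by (auto simp: separated_def good_def U_def q_def)
      show "separated r a b \<or> separated r b a"
        if "a \<in> insert y X" "b \<in> insert y X" "a \<noteq> b" for a b
        using that sep X(1) by (auto simp: good_def)
      fix a z assume az: "a \<in> insert y X" "z \<in> U (insert y X)"
      then have z: "z \<in> U X" by (auto simp: U_def)
      show "r z \<le> q * r a"
      proof (cases "a = y")
        case True
        have "S \<le> q * r y"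
          using y(2) q by (simp add: field_simps)
        then show ?thesis
          using le_S[OF z] True by simp
      next
        case False
        then show ?thesis
          using az z X(1) by (auto simp: good_def)
      qed
    qed (use X(1) y UK in \<open>auto simp: good_def\<close>)
    then have "card (insert y X) \<le> card X"
      by (rule X(2))
    then show False
      using \<open>y \<notin> X\<close> X(1) by (simp add: good_def)
  qed
  then show ?thesis
    using X(1) unfolding good_def U_def by (intro exI[of _ X]) auto
qed

end

text \<open>The multiplicity bound depends on the dimension only. That each member meets
  \<open>K\<close> is recorded so that members belonging to outer shells can later be excluded from
  inner balls.\<close>

lemma (in centred_body_measure) exists_cover_bounded_multiplicity:
  assumes "bounded K"
  obtains \<F> where "finite \<F>" "K \<subseteq> \<Union>\<F>"
    "\<And>A. A \<in> \<F> \<Longrightarrow> A \<inter> K \<noteq> {} \<and> emeasure \<mu> A = m \<and> (\<exists>r x. r > 0 \<and> A = homothet r x C)"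
    "\<And>p. card {A \<in> \<F>. p \<in> A} \<le> (4 * DIM('a) + 5) ^ DIM('a)"
proof -
  obtain r where r: "\<And>x. r x > 0" "\<And>x. emeasure \<mu> (homothet (r x) x C) = m"
    using exists_radius by metis
  obtain R where R: "\<And>x. x \<in> K \<Longrightarrow> r x \<le> R"
    using radius_bounded_above[of r, OF r assms] by blast
  obtain \<rho> where \<rho>: "\<rho> > 0" "\<And>x. x \<in> K \<Longrightarrow> \<rho> \<le> r x"
    using radius_bounded_below[of r, OF r assms] by blast
  obtain X where X: "finite X" "X \<subseteq> K" "K \<subseteq> (\<Union>x\<in>X. homothet (r x) x C)"
    "\<forall>x\<in>X. \<forall>y\<in>X. x \<noteq> y \<longrightarrow> separated r x y \<or> separated r y x"
    using exists_separated_cover[of K \<rho> r R, OF assms \<rho> R] by auto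
  define \<F> where "\<F> = (\<lambda>x. homothet (r x) x C) ` X"
  show thesis
  proof (rule that[of \<F>])
    show "finite \<F>" "K \<subseteq> \<Union>\<F>"
      using X by (auto simp: \<F>_def)
    show "A \<inter> K \<noteq> {} \<and> emeasure \<mu> A = m \<and> (\<exists>r x. r > 0 \<and> A = homothet r x C)"
      if "A \<in> \<F>" for A
      using that r X(2) center_mem unfolding \<F>_def by blast
    fix p
    have "{A \<in> \<F>. p \<in> A} = (\<lambda>x. homothet (r x) x C) ` {x \<in> X. p \<in> homothet (r x) x C}"
      by (auto simp: \<F>_def)
    then have "card {A \<in> \<F>. p \<in> A} \<le> card {x \<in> X. p \<in> homothet (r x) x C}"
      using X(1) by (simp add: card_image_le)
    also have "\<dots> \<le> (4 * DIM('a) + 5) ^ DIM('a)"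
      using X r by (intro multiplicity_le) auto
    finally show "card {A \<in> \<F>. p \<in> A} \<le> (4 * DIM('a) + 5) ^ DIM('a)" .
  qed
qed

section \<open>The covering of the whole space\<close>

text \<open>The sum of the measures is the integral of the counting function, which is at most
  \<open>b\<close> on \<open>D\<close> and vanishes elsewhere.\<close>

lemma sum_emeasure_le_multiplicity:
  assumes "finite F" "F \<subseteq> sets M" "D \<in> sets M" "\<And>A. A \<in> F \<Longrightarrow> A \<subseteq> D"
    and mult: "\<And>p. card {A \<in> F. p \<in> A} \<le> b"
  shows "(\<Sum>A\<in>F. emeasure M A) \<le> of_nat b * emeasure M D"
proof -
  have "(\<Sum>A\<in>F. emeasure M A) = (\<Sum>A\<in>F. \<integral>\<^sup>+p. indicator A p \<partial>M)"
    using assms by (intro sum.cong) auto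
  also have "\<dots> = (\<integral>\<^sup>+p. (\<Sum>A\<in>F. indicator A p) \<partial>M)"
    using assms by (intro nn_integral_sum[symmetric]) auto
  also have "\<dots> \<le> (\<integral>\<^sup>+p. of_nat b * indicator D p \<partial>M)"
  proof (rule nn_integral_mono)
    fix p
    have *: "(\<Sum>A\<in>F. indicator A p) = (of_nat (card {A \<in> F. p \<in> A}) :: ennreal)"
      using assms(1) by (simp add: indicator_def sum.If_cases Int_def)
    show "(\<Sum>A\<in>F. indicator A p) \<le> (of_nat b * indicator D p :: ennreal)"
    proof (cases "p \<in> D")
      case True
      then show ?thesis
        using mult[of p] unfolding * by (simp add: of_nat_mono)
    next
      case False
      then have "{A \<in> F. p \<in> A} = {}"
        using assms(4) by blast
      then show ?thesis
        unfolding * by (metis card.empty of_nat_0 zero_le)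
    qed
  qed
  also have "\<dots> = of_nat b * emeasure M D"
    using assms(3) by (simp add: nn_integral_cmult_indicator)
  finally show ?thesis .
qed

lemma d_inn_le:
  assumes "emeasure \<mu> D < \<infinity>"
    and "\<And>F. \<lbrakk>finite F; F \<subseteq> {A \<in> \<A>. A \<subseteq> D}\<rbrakk> \<Longrightarrow> (\<Sum>A\<in>F. emeasure \<mu> A) \<le> c * emeasure \<mu> D"
  shows "d_inn \<mu> \<A> D \<le> c"
proof -
  define S where "S = (SUP F \<in> {F. finite F \<and> F \<subseteq> {A \<in> \<A>. A \<subseteq> D}}. \<Sum>A\<in>F. emeasure \<mu> A)"
  have "S \<le> c * emeasure \<mu> D"
    unfolding S_def using assms(2) by (intro SUP_least) auto
  then have "S / emeasure \<mu> D \<le> c"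
    \<comment> \<open>For a null \<open>D\<close> the supremum \<open>S\<close> is 0 as well, and 0
      / 0 is 0 in \<open>ennreal\<close>.\<close>
    by (cases "emeasure \<mu> D = 0") (auto simp: zero_less_iff_neq_zero mult.commute intro!: divide_le_posI_ennreal)
  then show ?thesis
    by (simp add: d_inn_def S_def)
qed

text \<open>A lower limit above \<open>c\<close> would force values above \<open>c\<close> at all
  large radii, in particular along the sequence. Hence only a sparse set of radii has to be
  controlled.\<close>

lemma d_low_le_of_sequence:
  assumes "filterlim \<rho> at_top sequentially" "\<And>k::nat. d_inn \<mu> \<A> (ball 0 (\<rho> k)) \<le> c"
  shows "d_low \<mu> \<A> \<le> c"
proof (rule ccontr)
  assume "\<not> d_low \<mu> \<A> \<le> c"
  then have "eventually (\<lambda>t. c < d_inn \<mu> \<A> (ball 0 t)) at_top"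
    unfolding d_low_def by (intro less_LiminfD) simp
  then have "eventually (\<lambda>k. c < d_inn \<mu> \<A> (ball 0 (\<rho> k))) sequentially"
    using assms(1) by (rule eventually_compose_filterlim)
  then show False
    using assms(2) by (auto simp: eventually_sequentially not_le[symmetric])
qed

text \<open>The radii \<open>\<rho> k\<close> grow so fast that the homothets covering the shells up to \<open>\<rho> k\<close> have
  total measure at most that of the ball of radius \<open>\<rho> (k + 1)\<close>.\<close>

lemma (in centred_body_measure) exists_cover_low_density:
  obtains \<C> where "\<Union>\<C> = UNIV"
    "\<And>A. A \<in> \<C> \<Longrightarrow> emeasure \<mu> A = m \<and> (\<exists>r x. r > 0 \<and> A = homothet r x C)"
    "d_low \<mu> \<C> \<le> of_nat ((4 * DIM('a) + 5) ^ DIM('a) + 1)"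
proof -
  define \<beta> where "\<beta> = (4 * DIM('a) + 5) ^ DIM('a)"
  \<comment> \<open>Shells contain their inner sphere but not the outer one, so that consecutive
    shells leave no gap.\<close>
  define shell where "shell a b = ball (0 :: 'a) b - ball 0 a" for a b
  define covers where "covers a b F \<longleftrightarrow> finite F \<and> shell a b \<subseteq> \<Union>F
      \<and> (\<forall>A\<in>F. A \<inter> shell a b \<noteq> {} \<and> emeasure \<mu> A = m \<and> (\<exists>r x. r > 0 \<and> A = homothet r x C))
      \<and> (\<forall>p. card {A \<in> F. p \<in> A} \<le> \<beta>)" for a b F
  have "\<exists>F. covers a b F" for a b
  proof -
    have "bounded (shell a b)"
      unfolding shell_def by (rule bounded_diff) simp
    then show ?thesis
      unfolding \<beta>_def covers_def by (rule exists_cover_bounded_multiplicity) blast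
  qed
  then obtain Fam where "\<And>a b. covers a b (Fam a b)"
    by metis
  then have fin: "finite (Fam a b)"
    and cov: "shell a b \<subseteq> \<Union>(Fam a b)"
    and mem: "A \<in> Fam a b \<Longrightarrow>
      A \<inter> shell a b \<noteq> {} \<and> emeasure \<mu> A = m \<and> (\<exists>r x. r > 0 \<and> A = homothet r x C)"
    and mult: "card {A \<in> Fam a b. p \<in> A} \<le> \<beta>" for a b p A
    unfolding covers_def by auto
  \<comment> \<open>The state pairs a radius with the number of homothets counted so far. Steps of
    length at least 1 drive the radii to infinity; the last conjunct, met because the total mass is
    infinite, makes the homothets counted so far cheap in the next ball.\<close>
  have "\<exists>g :: nat \<Rightarrow> real \<times> nat. \<forall>n. (n = 0 \<longrightarrow> fst (g n) = 0)
      \<and> (fst (g n) + 1 \<le> fst (g (Suc n))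
        \<and> snd (g (Suc n)) = snd (g n) + card (Fam (fst (g n)) (fst (g (Suc n))))
        \<and> of_nat (snd (g n)) * m \<le> emeasure \<mu> (ball 0 (fst (g (Suc n)))))"
  proof (rule dependent_nat_choice)
    show "\<exists>x :: real \<times> nat. (0::nat) = 0 \<longrightarrow> fst x = 0"
      by (intro exI[of _ "(0, 0)"]) simp
    fix x :: "real \<times> nat" and n :: nat
    have "of_nat (snd x) * m < \<infinity>"
      using m_fin by (simp add: ennreal_mult_less_top of_nat_less_top)
    then obtain k where k: "of_nat (snd x) * m < emeasure \<mu> (ball (0::'a) k)"
      using exists_ball_emeasure_gt by blast
    define t where "t = max (fst x + 1) k"
    have "emeasure \<mu> (ball (0::'a) k) \<le> emeasure \<mu> (ball 0 t)"
      by (rule emeasure_mono) (auto simp: t_def sets_eq)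
    then show "\<exists>y. (Suc n = 0 \<longrightarrow> fst y = 0) \<and> (fst x + 1 \<le> fst y
        \<and> snd y = snd x + card (Fam (fst x) (fst y))
        \<and> of_nat (snd x) * m \<le> emeasure \<mu> (ball 0 (fst y)))"
      using k by (intro exI[of _ "(t, snd x + card (Fam (fst x) t))"]) (auto simp: t_def)
  qed
  then obtain g :: "nat \<Rightarrow> real \<times> nat" where g: "fst (g 0) = 0"
    "\<And>n. fst (g n) + 1 \<le> fst (g (Suc n))"
    "\<And>n. snd (g (Suc n)) = snd (g n) + card (Fam (fst (g n)) (fst (g (Suc n))))"
    "\<And>n. of_nat (snd (g n)) * m \<le> emeasure \<mu> (ball 0 (fst (g (Suc n))))"
    by metis
  define \<rho> where "\<rho> n = fst (g n)" for n
  define L where "L n = Fam (\<rho> n) (\<rho> (Suc n))" for n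
  define E where "E n = (\<Union>j<n. L j)" for n
  have "\<rho> n \<le> \<rho> (Suc n)" for n
    using g(2)[of n] by (simp add: \<rho>_def)
  then have \<rho>_mono: "\<rho> i \<le> \<rho> j" if "i \<le> j" for i j
    using that by (rule lift_Suc_mono_le)
  have \<rho>_ge: "real n \<le> \<rho> n" for n
  proof (induction n)
    case (Suc n)
    then show ?case using g(2)[of n] by (simp add: \<rho>_def)
  qed (simp add: \<rho>_def g)
  have finE: "finite (E n)" for n
    unfolding E_def L_def using fin by blast
  have cardE: "card (E n) \<le> snd (g n)" for n
  proof (induction n)
    case (Suc n)
    have "E (Suc n) = E n \<union> L n"
      by (auto simp: E_def lessThan_Suc)
    then have "card (E (Suc n)) \<le> card (E n) + card (L n)"
      by (simp add: card_Un_le)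
    then show ?case
      using Suc g(3)[of n] by (simp add: L_def \<rho>_def)
  qed (simp add: E_def)
  define \<C> where "\<C> = (\<Union>n. L n)"
  have memC: "emeasure \<mu> A = m \<and> (\<exists>r x. r > 0 \<and> A = homothet r x C)" if "A \<in> \<C>" for A
    using that mem unfolding \<C>_def L_def by blast
  have density: "d_inn \<mu> \<C> (ball 0 (\<rho> (Suc k))) \<le> of_nat (\<beta> + 1)" for k
  proof (rule d_inn_le)
    define D where "D = ball (0::'a) (\<rho> (Suc k))"
    show "emeasure \<mu> (ball 0 (\<rho> (Suc k))) < \<infinity>"
      by (rule emeasure_bounded_finite) simp
    fix F assume F: "finite F" "F \<subseteq> {A \<in> \<C>. A \<subseteq> ball 0 (\<rho> (Suc k))}"
    \<comment> \<open>A member of a shell with index above \<open>k\<close> meets the complement of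
      the ball. What remains after removing the earlier families comes from the single family
      \<open>L k\<close>, whose multiplicity is bounded.\<close>
    have late: "F - E k \<subseteq> L k"
    proof
      fix A assume A: "A \<in> F - E k"
      then obtain j where j: "A \<in> L j"
        using F(2) by (auto simp: \<C>_def)
      have "A \<subseteq> D"
        using A F(2) by (auto simp: D_def)
      have "A \<inter> shell (\<rho> j) (\<rho> (Suc j)) \<noteq> {}"
        using mem j unfolding L_def by blast
      then obtain p where "p \<in> D" "p \<notin> ball 0 (\<rho> j)"
        using \<open>A \<subseteq> D\<close> unfolding shell_def by blast
      then have "\<rho> j < \<rho> (Suc k)"
        by (simp add: D_def)
      then have "j < Suc k"
        using \<rho>_mono[of "Suc k" j] by (meson not_le)
      moreover have "\<not> j < k"
        using A j by (auto simp: E_def)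
      ultimately have "j = k" by simp
      then show "A \<in> L k" using j by simp
    qed
    have "(\<Sum>A\<in>F \<inter> E k. emeasure \<mu> A) = of_nat (card (F \<inter> E k)) * m"
      using F(2) memC by (subst sum.cong[where h = "\<lambda>_. m"]) auto
    also have "\<dots> \<le> of_nat (snd (g k)) * m"
    proof (rule mult_right_mono)
      have "card (F \<inter> E k) \<le> card (E k)"
        using finE by (intro card_mono) auto
      then show "of_nat (card (F \<inter> E k)) \<le> (of_nat (snd (g k)) :: ennreal)"
        using cardE[of k] by (simp add: of_nat_mono)
    qed simp
    also have "\<dots> \<le> emeasure \<mu> D"
      using g(4)[of k] by (simp add: D_def \<rho>_def)
    finally have early_sum: "(\<Sum>A\<in>F \<inter> E k. emeasure \<mu> A) \<le> emeasure \<mu> D" .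
    have late_sum: "(\<Sum>A\<in>F - E k. emeasure \<mu> A) \<le> of_nat \<beta> * emeasure \<mu> D"
    proof (rule sum_emeasure_le_multiplicity)
      show "F - E k \<subseteq> sets \<mu>"
        using F(2) memC homothet_sets by blast
      show "D \<in> sets \<mu>" by (simp add: D_def sets_eq)
      show "A \<subseteq> D" if "A \<in> F - E k" for A
        using that F(2) by (auto simp: D_def)
      fix p
      have "card {A \<in> F - E k. p \<in> A} \<le> card {A \<in> L k. p \<in> A}"
        using late fin by (intro card_mono) (auto simp: L_def)
      also have "\<dots> \<le> \<beta>"
        using mult by (simp add: L_def)
      finally show "card {A \<in> F - E k. p \<in> A} \<le> \<beta>" .
    qed (use F in simp)
    have "(\<Sum>A\<in>F. emeasure \<mu> A)
        = (\<Sum>A\<in>F \<inter> E k. emeasure \<mu> A) + (\<Sum>A\<in>F - E k. emeasure \<mu> A)"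
      using F(1) by (rule sum.Int_Diff)
    also have "\<dots> \<le> emeasure \<mu> D + of_nat \<beta> * emeasure \<mu> D"
      using early_sum late_sum by (rule add_mono)
    also have "\<dots> = of_nat (\<beta> + 1) * emeasure \<mu> D"
      by (simp add: distrib_right add.commute)
    finally show "(\<Sum>A\<in>F. emeasure \<mu> A) \<le> of_nat (\<beta> + 1) * emeasure \<mu> (ball 0 (\<rho> (Suc k)))"
      by (simp add: D_def)
  qed
  show thesis
  proof (rule that[of \<C>])
    have "\<exists>A\<in>\<C>. p \<in> A" for p
    proof -
      obtain k where k: "norm p < real k"
        using reals_Archimedean2 by blast
      \<comment> \<open>Since \<open>\<rho> 0 = 0\<close>, the least such index is positive, and its
        predecessor names the shell of \<open>p\<close>.\<close>
      define l where "l = (LEAST k. norm p < \<rho> k)"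
      have "norm p < \<rho> k"
        using k \<rho>_ge[of k] by simp
      then have l: "norm p < \<rho> l"
        unfolding l_def by (rule LeastI)
      moreover have "\<rho> 0 = 0"
        by (simp add: \<rho>_def g)
      ultimately obtain j where j: "l = Suc j"
        by (cases l) auto
      have "\<not> norm p < \<rho> j"
        using not_less_Least[of j "\<lambda>k. norm p < \<rho> k"] j l_def by simp
      then have "p \<in> shell (\<rho> j) (\<rho> (Suc j))"
        using l j by (simp add: shell_def)
      then have "p \<in> \<Union>(L j)"
        using cov unfolding L_def by blast
      then show ?thesis
        unfolding \<C>_def by blast
    qed
    then show "\<Union>\<C> = UNIV" by blast
    have "filterlim \<rho> at_top sequentially"
      using \<rho>_ge by (intro filterlim_at_top_mono[OF filterlim_real_sequentially]) auto
    then have "filterlim (\<lambda>k. \<rho> (Suc k)) at_top sequentially"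
      by (rule filterlim_compose[OF _ filterlim_Suc])
    then show "d_low \<mu> \<C> \<le> of_nat ((4 * DIM('a) + 5) ^ DIM('a) + 1)"
      using density unfolding \<beta>_def by (rule d_low_le_of_sequence)
  qed (use memC in blast)
qed

section \<open>Reduction to a centred body and conclusion\<close>

text \<open>The centre found by Helly's theorem is moved to the origin. The origin is interior
  because it lies strictly between an interior point \<open>z\<close> and the point
  \<open>- (z /\<^sub>R n)\<close> of the body.\<close>

lemma centred_body_translate:
  fixes C :: "'a::euclidean_space set"
  assumes "convex_body C"
  obtains c where "centred_body (homothet 1 (- c) C)"
proof -
  have C: "convex C" "compact C" "interior C \<noteq> {}"
    using assms by (auto simp: convex_body_def)
  define n where "n = real DIM('a)"
  have n: "n > 0" by (simp add: n_def)
  have "C \<noteq> {}"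
    using C(3) by auto
  then obtain c where c: "c \<in> C" "\<And>x. x \<in> C \<Longrightarrow> \<exists>y\<in>C. c - x = n *\<^sub>R (y - c)"
    using exists_centre[OF C(1,2)] unfolding n_def by metis
  define B where "B = homothet 1 (- c) C"
  have B: "convex B" "compact B"
    unfolding B_def using C convex_homothet compact_homothet by blast+
  have reflect: "- (x /\<^sub>R n) \<in> B" if "x \<in> B" for x
  proof -
    obtain u where u: "u \<in> C" "x = u - c"
      using \<open>x \<in> B\<close> by (auto simp: B_def mem_homothet)
    obtain y where y: "y \<in> C" "c - u = n *\<^sub>R (y - c)"
      using c(2)[OF u(1)] by blast
    have "- (x /\<^sub>R n) = (c - u) /\<^sub>R n"
      by (simp add: u(2) flip: scaleR_minus_right)
    also have "\<dots> = y - c"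
      using n by (simp add: y(2))
    finally show ?thesis
      using y(1) by (auto simp: B_def mem_homothet)
  qed
  have "interior B \<noteq> {}"
    using C(3) interior_homothet[of 1 "- c" C] by (simp add: B_def homothet_def)
  then obtain z where z: "z \<in> interior B" by blast
  \<comment> \<open>This is the weight of \<open>z\<close> for which the combination with
    \<open>- (z /\<^sub>R n)\<close> vanishes.\<close>
  define e where "e = 1 / (n + 1)"
  have "- (z /\<^sub>R n) \<in> B"
    using z interior_subset reflect by blast
  then have "- (z /\<^sub>R n) - e *\<^sub>R (- (z /\<^sub>R n) - z) \<in> interior B"
    using B(1) z n by (intro mem_interior_convex_shrink) (auto simp: e_def)
  also have "- (z /\<^sub>R n) - e *\<^sub>R (- (z /\<^sub>R n) - z) = (e * (1 / n + 1) - 1 / n) *\<^sub>R z"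
    by (simp add: algebra_simps divide_inverse)
  also have "e * (1 / n + 1) - 1 / n = 0"
    using n by (simp add: e_def divide_simps)
  finally have "0 \<in> interior B" by simp
  then have "centred_body B"
    using B reflect by unfold_locales (auto simp: n_def)
  then show thesis
    using that B_def by blast
qed

theorem mainTheorem4:
  "\<exists>F :: nat \<Rightarrow> real. \<forall>(C :: 'a::euclidean_space set) (\<mu> :: 'a measure).
     convex_body C \<and> locally_finite_borel \<mu> \<and> non_degenerate \<mu> C \<and>
     emeasure \<mu> C > 0 \<and> emeasure \<mu> UNIV = \<infinity> \<longrightarrow>
     homothety_covering_density \<mu> C \<le> ennreal (F DIM('a))"
proof (intro exI allI impI, elim conjE)
  fix C :: "'a set" and \<mu> :: "'a measure"
  assume C: "convex_body C" and lf: "locally_finite_borel \<mu>" and nd: "non_degenerate \<mu> C"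
    and pos: "emeasure \<mu> C > 0" and inf: "emeasure \<mu> UNIV = \<infinity>"
  obtain c where c: "centred_body (homothet 1 (- c) C)"
    using centred_body_translate[OF C] by blast
  define B where "B = homothet 1 (- c) C"
  \<comment> \<open>Homothets of the translate are homothets of \<open>C\<close> with the same
    ratio, so non-degeneracy passes to \<open>B\<close> and the covering by homothets of
    \<open>B\<close> is admissible for \<open>C\<close>.\<close>
  have hom: "homothet r x B = homothet r (x - r *\<^sub>R c) C" for r x
    by (simp add: B_def homothet_homothet)
  have "emeasure \<mu> C < \<infinity>"
    using C lf by (auto simp: convex_body_def locally_finite_borel_def)
  moreover have "non_degenerate \<mu> B"
    using nd by (simp add: non_degenerate_def hom)
  moreover have "centred_body B"
    using c by (simp add: B_def)
  ultimately interpret centred_body_measure B \<mu> "emeasure \<mu> C"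
    using lf pos inf by (intro centred_body_measure.intro centred_body_measure_axioms.intro)
  obtain \<C> where \<C>: "\<Union>\<C> = UNIV"
    "\<And>A. A \<in> \<C> \<Longrightarrow> emeasure \<mu> A = emeasure \<mu> C \<and> (\<exists>r x. r > 0 \<and> A = homothet r x B)"
    "d_low \<mu> \<C> \<le> of_nat ((4 * DIM('a) + 5) ^ DIM('a) + 1)"
    using exists_cover_low_density by blast
  have "homothety_covering_density \<mu> C \<le> d_low \<mu> \<C>"
    unfolding homothety_covering_density_def
  proof (rule INF_lower, intro CollectI conjI ballI)
    fix A assume "A \<in> \<C>"
    then show "is_homothet_of A C" "emeasure \<mu> A = emeasure \<mu> C"
      using \<C>(2)[of A] unfolding is_homothet_of_def hom by blast+
  qed (rule \<C>(1))
  also have "\<dots> \<le> of_nat ((4 * DIM('a) + 5) ^ DIM('a) + 1)"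
    by (rule \<C>(3))
  also have "\<dots> = ennreal (real ((4 * DIM('a) + 5) ^ DIM('a) + 1))"
    by (rule ennreal_of_nat_eq_real_of_nat)
  \<comment> \<open>The witness left open by \<open>exI\<close> is fixed here: the power bounds the
    multiplicity within one shell, and the summand 1 pays for all earlier shells.\<close>
  finally show "homothety_covering_density \<mu> C
      \<le> ennreal ((\<lambda>d. real ((4 * d + 5) ^ d + 1)) DIM('a))"
    by simp
qed

end
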